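(* The cipher E-DES is not pure: it is not the case that for all keys $k,k',k''\in\{0,1,2\}^{20}$ there exists a key $k'''\in\{0,1,2\}^{20}$ with $T_{k}\circ T_{k'}^{-1}\circ T_{k''}=T_{k'''}$, where $T_k$ denotes the E-DES encryption permutation of $\{0,1,2\}^{18}$ with key $k$.
   Context: A cryptosystem with encryption permutations $T_k$ ($k$ in the key space) is called pure if for every three keys $k,k',k''$ there exists a key $k'''$ such that $T_kT_{k'}^{-1}T_{k''}=T_{k'''}$. Definition of E-DES. All entries ("nits") lie in $\mathbb{Z}_3=\{0,1,2\}$; $\oplus$ denotes entrywise addition modulo 3. The message space and ciphertext space are $\{0,1,2\}^{18}$, the key space is $\{0,1,2\}^{20}$. A list $(a_1,\dots,a_r)$ of positions acts on a string $s$ by producing the string $s_{a_1}s_{a_2}\cdots s_{a_r}$. Key schedule: for a key $k$ the 15-nit subkeys $k_1,k_2$ are obtained by applying to $k$ the lists $CP_1=(16,17,12,15,20,10,11,3,7,19,13,9,8,1,18)$ and $CP_2=(6,7,2,20,4,3,9,8,18,10,15,14,11,12,5)$ respectively. Initial permutation: $P$ applies the list $(11,12,2,13,9,1,5,8,16,17,4,18,15,7,10,3,6,14)$ to an 18-nit string; $P^{-1}$ is its inverse. Expansion: $E:\{0,1,2\}^9\to\{0,1,2\}^{15}$ applies the list $(9,1,2,3,4,5,6,3,4,5,6,7,8,9,1)$. Round function: for a 15-nit subkey $\kappa$ and $R\in\{0,1,2\}^9$, form $E(R)\oplus\kappa$ and split it into three consecutive 5-nit blocks. Block number $p$ ($p=1,2,3$),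 say $n_1n_2n_3n_4n_5$, selects the entry of S-box $p$ in row $3n_1+n_5$ (rows numbered 0 to 8) and column $9n_2+3n_3+n_4$ (columns numbered 0 to 26); this entry, an integer between 0 and 26, is written as a 3-digit base-3 string (most significant digit first). Then $f_\kappa(R)\in\{0,1,2\}^9$ is the concatenation of the outputs of S-boxes 1, 2, 3 in this order. Encryption: with $\sigma_f(x,y)=(y,x\oplus f(y))$ and $\theta(x,y)=(y,x)$ for $x,y\in\{0,1,2\}^9$ (left and right halves), $T_k=P^{-1}\circ\theta\circ\sigma_{f_{k_2}}\circ\sigma_{f_{k_1}}\circ P$. S-box 1 (rows 0 to 8): row 0: 24,25,6,16,3,7,1,18,26,5,10,9,19,23,13,12,15,8,20,17,2,11,0,21,14,4,22 row 1: 17,18,26,9,23,0,21,11,19,25,3,2,12,16,6,5,8,1,13,10,22,4,20,14,7,24,15 row 2: 16,17,25,8,22,26,20,10,18,24,2,1,11,15,5,4,7,0,12,9,21,3,19,13,6,23,14 row 3: 10,11,19,2,16,20,14,4,12,18,23,22,5,9,26,25,1,21,6,3,15,24,13,7,0,17,8 row 4: 21,22,3,23,0,4,25,15,23,2,7,6,16,20,10,9,12,5,17,14,26,8,24,18,11,1,19 row 5: 26,0,8,18,5,9,3,20,1,7,12,11,21,25,15,14,17,10,22,19,4,13,2,23,16,6,24 row 6: 3,4,12,22,9,13,7,24,5,11,16,15,25,2,19,18,21,14,26,23,8,17,6,0,20,10,1 row 7: 5,6,14,24,11,15,9,26,7,13,18,17,0,4,21,20,23,16,1,25,10,19,8,2,22,12,3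 row 8: 11,12,20,3,17,21,15,5,13,19,24,23,6,10,0,26,2,22,7,4,16,25,14,8,1,18,9 S-box 2 (rows 0 to 8): row 0: 1,2,10,20,7,11,5,22,3,9,14,13,23,0,17,16,19,12,24,21,6,15,4,25,18,8,26 row 1: 25,26,7,17,22,8,2,19,0,6,11,10,20,24,14,13,16,9,21,18,3,12,1,22,15,5,23 row 2: 14,15,23,6,20,24,18,8,16,22,0,26,9,13,3,2,5,25,10,7,19,1,17,11,4,21,12 row 3: 9,10,18,1,15,19,13,3,11,17,22,21,4,8,25,24,0,20,5,2,14,23,12,6,26,16,7 row 4: 23,24,5,15,2,6,0,17,25,4,9,8,18,22,12,11,14,7,19,16,1,10,26,20,13,3,21 row 5: 2,3,11,21,8,12,6,23,4,10,15,14,24,1,18,17,20,13,25,22,7,16,5,26,19,9,0 row 6: 18,19,0,10,24,1,22,12,20,26,4,3,13,17,7,6,9,2,14,11,23,5,21,15,8,25,16 row 7: 15,16,24,7,21,25,19,9,17,23,1,0,10,14,4,3,6,9,13,8,20,2,18,12,5,22,13 row 8: 2,23,4,14,1,5,26,16,24,3,8,7,17,21,11,10,13,16,18,15,0,9,25,19,12,2,20 S-box 3 (rows 0 to 8): row 0: 4,5,13,23,10,14,8,25,6,12,17,16,26,3,20,19,22,15,0,24,9,18,7,1,21,11,2 row 1: 6,7,15,25,12,16,10,0,8,14,19,18,1,5,22,21,24,17,2,26,11,20,9,3,23,13,4 row 2: 7,8,16,26,13,17,11,1,9,15,20,19,2,6,23,22,25,18,3,0,12,21,10,4,24,14,5 row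 3: 8,9,17,0,14,18,12,2,10,16,21,20,3,7,24,23,26,19,4,1,13,22,11,5,25,15,6 row 4: 13,14,22,5,19,23,17,7,15,21,26,25,8,12,2,1,4,24,9,6,18,0,16,10,3,20,11 row 5: 12,13,21,4,18,22,16,6,14,20,25,24,7,11,1,0,3,23,8,5,17,26,15,9,2,19,10 row 6: 19,20,1,11,25,2,23,13,21,0,5,4,14,18,10,7,10,3,15,12,24,6,22,16,9,26,17 row 7: 0,1,9,19,6,10,4,21,2,8,13,12,22,26,16,15,18,11,23,20,5,14,3,24,17,7,25 row 8: 20,21,2,12,26,3,24,14,22,1,6,5,15,19,9,8,11,4,16,13,25,7,23,17,10,0,18 *)

theory Defs
  imports Main
begin

text \<open>
  A cryptosystem is given by a key space \<open>K\<close>, a message space \<open>M\<close> (which is also the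
  ciphertext space) and encryption maps \<open>T k\<close>, intended to be permutations of \<open>M\<close>.  Only the
  values of \<open>T k\<close> on \<open>M\<close> matter, so the inverse is taken relative to \<open>M\<close> and
  equality of permutations is equality on \<open>M\<close>.
\<close>

definition pure_cryptosystem :: "'k set \<Rightarrow> 'm set \<Rightarrow> ('k \<Rightarrow> 'm \<Rightarrow> 'm) \<Rightarrow> bool" where
  "pure_cryptosystem K M T \<longleftrightarrow>
    (\<forall>k\<in>K. \<forall>k'\<in>K. \<forall>k''\<in>K. \<exists>k'''\<in>K.
       \<forall>x\<in>M. (T k \<circ> inv_into M (T k') \<circ> T k'') x = T k''' x)"

definition nit_strings :: "nat \<Rightarrow> nat list set" where
  "nit_strings n = {s. length s = n \<and> set s \<subseteq> {0, 1, 2}}"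

text \<open>Positions are numbered from 1, whereas list indexing starts at 0.\<close>

definition apply_positions :: "nat list \<Rightarrow> nat list \<Rightarrow> nat list" where
  "apply_positions as s = map (\<lambda>a. s ! (a - 1)) as"

definition nit_add :: "nat list \<Rightarrow> nat list \<Rightarrow> nat list" where
  "nit_add s t = map2 (\<lambda>a b. (a + b) mod 3) s t"

definition edes_keys :: "nat list set" where
  "edes_keys = nit_strings 20"

definition edes_messages :: "nat list set" where
  "edes_messages = nit_strings 18"

definition subkey1 :: "nat list \<Rightarrow> nat list" where
  "subkey1 = apply_positions [16,17,12,15,20,10,11,3,7,19,13,9,8,1,18]"

definition subkey2 :: "nat list \<Rightarrow> nat list" where
  "subkey2 = apply_positions [6,7,2,20,4,3,9,8,18,10,15,14,11,12,5]"

definition initial_perm :: "nat list \<Rightarrow> nat list" where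
  "initial_perm = apply_positions [11,12,2,13,9,1,5,8,16,17,4,18,15,7,10,3,6,14]"

definition expansion :: "nat list \<Rightarrow> nat list" where
  "expansion = apply_positions [9,1,2,3,4,5,6,3,4,5,6,7,8,9,1]"

definition sbox1 :: "nat list list" where
  "sbox1 = [
    [24,25,6,16,3,7,1,18,26,5,10,9,19,23,13,12,15,8,20,17,2,11,0,21,14,4,22],
    [17,18,26,9,23,0,21,11,19,25,3,2,12,16,6,5,8,1,13,10,22,4,20,14,7,24,15],
    [16,17,25,8,22,26,20,10,18,24,2,1,11,15,5,4,7,0,12,9,21,3,19,13,6,23,14],
    [10,11,19,2,16,20,14,4,12,18,23,22,5,9,26,25,1,21,6,3,15,24,13,7,0,17,8],
    [21,22,3,23,0,4,25,15,23,2,7,6,16,20,10,9,12,5,17,14,26,8,24,18,11,1,19],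
    [26,0,8,18,5,9,3,20,1,7,12,11,21,25,15,14,17,10,22,19,4,13,2,23,16,6,24],
    [3,4,12,22,9,13,7,24,5,11,16,15,25,2,19,18,21,14,26,23,8,17,6,0,20,10,1],
    [5,6,14,24,11,15,9,26,7,13,18,17,0,4,21,20,23,16,1,25,10,19,8,2,22,12,3],
    [11,12,20,3,17,21,15,5,13,19,24,23,6,10,0,26,2,22,7,4,16,25,14,8,1,18,9]]"

definition sbox2 :: "nat list list" where
  "sbox2 = [
    [1,2,10,20,7,11,5,22,3,9,14,13,23,0,17,16,19,12,24,21,6,15,4,25,18,8,26],
    [25,26,7,17,22,8,2,19,0,6,11,10,20,24,14,13,16,9,21,18,3,12,1,22,15,5,23],
    [14,15,23,6,20,24,18,8,16,22,0,26,9,13,3,2,5,25,10,7,19,1,17,11,4,21,12],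
    [9,10,18,1,15,19,13,3,11,17,22,21,4,8,25,24,0,20,5,2,14,23,12,6,26,16,7],
    [23,24,5,15,2,6,0,17,25,4,9,8,18,22,12,11,14,7,19,16,1,10,26,20,13,3,21],
    [2,3,11,21,8,12,6,23,4,10,15,14,24,1,18,17,20,13,25,22,7,16,5,26,19,9,0],
    [18,19,0,10,24,1,22,12,20,26,4,3,13,17,7,6,9,2,14,11,23,5,21,15,8,25,16],
    [15,16,24,7,21,25,19,9,17,23,1,0,10,14,4,3,6,9,13,8,20,2,18,12,5,22,13],
    [2,23,4,14,1,5,26,16,24,3,8,7,17,21,11,10,13,16,18,15,0,9,25,19,12,2,20]]"

definition sbox3 :: "nat list list" where
  "sbox3 = [
    [4,5,13,23,10,14,8,25,6,12,17,16,26,3,20,19,22,15,0,24,9,18,7,1,21,11,2],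
    [6,7,15,25,12,16,10,0,8,14,19,18,1,5,22,21,24,17,2,26,11,20,9,3,23,13,4],
    [7,8,16,26,13,17,11,1,9,15,20,19,2,6,23,22,25,18,3,0,12,21,10,4,24,14,5],
    [8,9,17,0,14,18,12,2,10,16,21,20,3,7,24,23,26,19,4,1,13,22,11,5,25,15,6],
    [13,14,22,5,19,23,17,7,15,21,26,25,8,12,2,1,4,24,9,6,18,0,16,10,3,20,11],
    [12,13,21,4,18,22,16,6,14,20,25,24,7,11,1,0,3,23,8,5,17,26,15,9,2,19,10],
    [19,20,1,11,25,2,23,13,21,0,5,4,14,18,10,7,10,3,15,12,24,6,22,16,9,26,17],
    [0,1,9,19,6,10,4,21,2,8,13,12,22,26,16,15,18,11,23,20,5,14,3,24,17,7,25],
    [20,21,2,12,26,3,24,14,22,1,6,5,15,19,9,8,11,4,16,13,25,7,23,17,10,0,18]]"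

definition base3_digits :: "nat \<Rightarrow> nat list" where
  "base3_digits v = [v div 9, v div 3 mod 3, v mod 3]"

definition sbox_output :: "nat list list \<Rightarrow> nat list \<Rightarrow> nat list" where
  "sbox_output S n =
     base3_digits (S ! (3 * n ! 0 + n ! 4) ! (9 * n ! 1 + 3 * n ! 2 + n ! 3))"

definition round_fun :: "nat list \<Rightarrow> nat list \<Rightarrow> nat list" where
  "round_fun \<kappa> R =
     (let b = nit_add (expansion R) \<kappa>
      in sbox_output sbox1 (take 5 b)
         @ sbox_output sbox2 (take 5 (drop 5 b))
         @ sbox_output sbox3 (drop 10 b))"

definition feistel_step ::
    "(nat list \<Rightarrow> nat list) \<Rightarrow> nat list \<times> nat list \<Rightarrow> nat list \<times> nat list" where
  "feistel_step f = (\<lambda>(x, y). (y, nit_add x (f y)))"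

definition swap_halves :: "nat list \<times> nat list \<Rightarrow> nat list \<times> nat list" where
  "swap_halves = (\<lambda>(x, y). (y, x))"

definition split_halves :: "nat list \<Rightarrow> nat list \<times> nat list" where
  "split_halves s = (take 9 s, drop 9 s)"

definition join_halves :: "nat list \<times> nat list \<Rightarrow> nat list" where
  "join_halves = (\<lambda>(x, y). x @ y)"

definition edes :: "nat list \<Rightarrow> nat list \<Rightarrow> nat list" where
  "edes k =
     inv_into edes_messages initial_perm \<circ> join_halves \<circ> swap_halves
     \<circ> feistel_step (round_fun (subkey2 k)) \<circ> feistel_step (round_fun (subkey1 k))
     \<circ> split_halves \<circ> initial_perm"

text \<open>
  Encryption is indeed a permutation of the message space for every key, so \<open>inv_into\<close> yields
  the genuine inverses in both places where it is used.
\<close>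

lemma nit_strings_iff:
  "s \<in> nit_strings n \<longleftrightarrow> length s = n \<and> (\<forall>i<n. s ! i < 3)"
proof -
  have "{0, 1, 2} = {..<3::nat}" by auto
  then show ?thesis
    by (auto simp: nit_strings_def subset_iff in_set_conv_nth)
qed

lemma finite_nit_strings: "finite (nit_strings n)"
  using finite_lists_length_eq[of "{0, 1, 2::nat}" n]
  by (simp add: nit_strings_def conj_commute)

lemma apply_positions_closed:
  assumes "s \<in> nit_strings n" "set as \<subseteq> {1..n}" "length as = m"
  shows "apply_positions as s \<in> nit_strings m"
proof -
  have "s ! (as ! i - 1) < 3" if "i < length as" for i
  proof -
    have "as ! i \<in> {1..n}" using assms(2) nth_mem[OF that] by blast
    then show ?thesis using assms(1) by (auto simp: nit_strings_iff)
  qed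
  then show ?thesis using assms(3) by (auto simp: apply_positions_def nit_strings_iff)
qed

lemma apply_positions_inj:
  assumes "s \<in> nit_strings n" "t \<in> nit_strings n" "{1..n} \<subseteq> set as"
    and eq: "apply_positions as s = apply_positions as t"
  shows "s = t"
proof (rule nth_equalityI)
  show "length s = length t" using assms by (simp add: nit_strings_iff)
  fix i assume "i < length s"
  then have "Suc i \<in> set as" using assms(1,3) by (auto simp: nit_strings_iff)
  then have "s ! (Suc i - 1) = t ! (Suc i - 1)"
    using eq unfolding apply_positions_def map_eq_conv by blast
  then show "s ! i = t ! i" by simp
qed

lemma nit_add_closed:
  "s \<in> nit_strings n \<Longrightarrow> t \<in> nit_strings n \<Longrightarrow> nit_add s t \<in> nit_strings n"
  by (auto simp: nit_add_def nit_strings_iff)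

lemma nit_add_cancel:
  assumes "s \<in> nit_strings n" "s' \<in> nit_strings n" "t \<in> nit_strings n"
    and eq: "nit_add s t = nit_add s' t"
  shows "s = s'"
proof (rule nth_equalityI)
  show "length s = length s'" using assms by (simp add: nit_strings_iff)
  fix i assume i: "i < length s"
  have "nit_add s t ! i = nit_add s' t ! i" using eq by simp
  then have "(s ! i + t ! i) mod 3 = (s' ! i + t ! i) mod 3"
    using assms(1-3) i by (simp add: nit_add_def nit_strings_iff)
  moreover have "s ! i < 3" "s' ! i < 3" using assms(1,2) i by (auto simp: nit_strings_iff)
  ultimately show "s ! i = s' ! i" by presburger
qed

lemma initial_perm_bij: "bij_betw initial_perm edes_messages edes_messages"
proof -
  let ?as = "[11,12,2,13,9,1,5,8,16,17,4,18,15,7,10,3,6,14] :: nat list"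
  have "initial_perm ` edes_messages \<subseteq> edes_messages"
    by (auto simp: edes_messages_def initial_perm_def intro!: apply_positions_closed)
  moreover have "inj_on initial_perm edes_messages"
  proof -
    have "set [1..<19] \<subseteq> set ?as" by code_simp
    moreover have "{1..18} = {1..<19::nat}" by auto
    ultimately have "{1..18} \<subseteq> set ?as"
      by (simp only: set_upt)
    then show ?thesis
      unfolding inj_on_def edes_messages_def initial_perm_def
      using apply_positions_inj by blast
  qed
  moreover have "finite edes_messages"
    by (simp add: edes_messages_def finite_nit_strings)
  ultimately show ?thesis
    by (simp add: bij_betw_def endo_inj_surj)
qed

lemma sbox_output_closed:
  assumes S: "length S = 9" "\<forall>r\<in>set S. length r = 27 \<and> (\<forall>v\<in>set r. v < 27)"
    and n: "n \<in> nit_strings 5"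
  shows "sbox_output S n \<in> nit_strings 3"
proof -
  have n': "n ! 0 < 3" "n ! 1 < 3" "n ! 2 < 3" "n ! 3 < 3" "n ! 4 < 3"
    using n by (auto simp: nit_strings_iff)
  let ?i = "3 * n ! 0 + n ! 4" and ?j = "9 * n ! 1 + 3 * n ! 2 + n ! 3"
  have "?i < length S" using n' S(1) by linarith
  then have "S ! ?i \<in> set S" by (rule nth_mem)
  then have len: "length (S ! ?i) = 27" and v: "\<forall>v\<in>set (S ! ?i). v < 27"
    using S(2) by blast+
  have "?j < length (S ! ?i)" using n' len by linarith
  then have "S ! ?i ! ?j < 27" using v nth_mem by blast
  moreover have "base3_digits w \<in> nit_strings 3" if "w < 27" for w
  proof -
    have "x \<in> {0, 1, 2}" if "x < 3" for x :: nat using that by auto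
    moreover have "w div 9 < 3" using that by linarith
    moreover have "w div 3 mod 3 < 3" "w mod 3 < 3" by simp_all
    ultimately show ?thesis
      unfolding base3_digits_def nit_strings_def by simp
  qed
  ultimately show ?thesis by (simp only: sbox_output_def)
qed

lemma sbox1_ok: "length sbox1 = 9" "\<forall>r\<in>set sbox1. length r = 27 \<and> (\<forall>v\<in>set r. v < 27)"
  by code_simp+

lemma sbox2_ok: "length sbox2 = 9" "\<forall>r\<in>set sbox2. length r = 27 \<and> (\<forall>v\<in>set r. v < 27)"
  by code_simp+

lemma sbox3_ok: "length sbox3 = 9" "\<forall>r\<in>set sbox3. length r = 27 \<and> (\<forall>v\<in>set r. v < 27)"
  by code_simp+

lemma round_fun_closed:
  assumes "\<kappa> \<in> nit_strings 15" "R \<in> nit_strings 9"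
  shows "round_fun \<kappa> R \<in> nit_strings 9"
proof -
  define b where "b = nit_add (expansion R) \<kappa>"
  have "expansion R \<in> nit_strings 15"
    unfolding expansion_def by (rule apply_positions_closed[OF assms(2)]) simp_all
  then have "b \<in> nit_strings 15"
    using assms(1) by (simp add: b_def nit_add_closed)
  then have blocks: "take 5 b \<in> nit_strings 5" "take 5 (drop 5 b) \<in> nit_strings 5"
      "drop 10 b \<in> nit_strings 5"
    by (auto simp: nit_strings_iff)
  have append: "s @ t \<in> nit_strings (m + n)"
    if "s \<in> nit_strings m" "t \<in> nit_strings n" for s t m n
    using that by (auto simp: nit_strings_def)
  have "sbox_output sbox1 (take 5 b) \<in> nit_strings 3"
    by (rule sbox_output_closed) (use blocks sbox1_ok in blast)+
  moreover have "sbox_output sbox2 (take 5 (drop 5 b)) \<in> nit_strings 3"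
    by (rule sbox_output_closed) (use blocks sbox2_ok in blast)+
  moreover have "sbox_output sbox3 (drop 10 b) \<in> nit_strings 3"
    by (rule sbox_output_closed) (use blocks sbox3_ok in blast)+
  ultimately have "sbox_output sbox1 (take 5 b) @ sbox_output sbox2 (take 5 (drop 5 b))
      @ sbox_output sbox3 (drop 10 b) \<in> nit_strings (3 + (3 + 3))"
    by (intro append)
  then show ?thesis by (simp add: round_fun_def b_def Let_def)
qed

lemma feistel_step_bij:
  assumes f: "\<And>y. y \<in> nit_strings n \<Longrightarrow> f y \<in> nit_strings n"
  shows "bij_betw (feistel_step f) (nit_strings n \<times> nit_strings n) (nit_strings n \<times> nit_strings n)"
proof -
  have "feistel_step f ` (nit_strings n \<times> nit_strings n) \<subseteq> nit_strings n \<times> nit_strings n"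
    using f by (auto simp: feistel_step_def nit_add_closed)
  moreover have "inj_on (feistel_step f) (nit_strings n \<times> nit_strings n)"
  proof (rule inj_onI, clarify)
    fix x y x' y'
    assume H: "x \<in> nit_strings n" "y \<in> nit_strings n" "x' \<in> nit_strings n"
      and eq: "feistel_step f (x, y) = feistel_step f (x', y')"
    from eq have y: "y = y'" and "nit_add x (f y) = nit_add x' (f y)"
      by (auto simp: feistel_step_def)
    then have "x = x'" by (intro nit_add_cancel[OF H(1,3) f[OF H(2)]])
    with y show "x = x' \<and> y = y'" by simp
  qed
  ultimately show ?thesis
    by (simp add: bij_betw_def endo_inj_surj finite_nit_strings)
qed

lemma edes_bij:
  assumes k: "k \<in> edes_keys"
  shows "bij_betw (edes k) edes_messages edes_messages"
proof -
  let ?H = "nit_strings 9"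
  have sub: "subkey1 k \<in> nit_strings 15" "subkey2 k \<in> nit_strings 15"
    using k unfolding subkey1_def subkey2_def edes_keys_def
    by (auto intro!: apply_positions_closed)
  have split: "bij_betw split_halves edes_messages (?H \<times> ?H)"
    by (rule bij_betw_byWitness[where f' = join_halves])
      (auto simp: split_halves_def join_halves_def edes_messages_def nit_strings_def
        dest: in_set_takeD in_set_dropD)
  have join: "bij_betw join_halves (?H \<times> ?H) edes_messages"
    by (rule bij_betw_byWitness[where f' = split_halves])
      (auto simp: split_halves_def join_halves_def edes_messages_def nit_strings_def
        dest: in_set_takeD in_set_dropD)
  have swap: "bij_betw swap_halves (?H \<times> ?H) (?H \<times> ?H)"
    by (rule bij_betw_byWitness[where f' = swap_halves]) (auto simp: swap_halves_def)
  have step: "bij_betw (feistel_step (round_fun \<kappa>)) (?H \<times> ?H) (?H \<times> ?H)"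
    if "\<kappa> \<in> nit_strings 15" for \<kappa>
    by (rule feistel_step_bij) (rule round_fun_closed[OF that])
  show ?thesis
    unfolding edes_def
    by (intro bij_betw_trans[OF initial_perm_bij] bij_betw_trans[OF split]
        bij_betw_trans[OF step[OF sub(1)]] bij_betw_trans[OF step[OF sub(2)]]
        bij_betw_trans[OF swap] bij_betw_trans[OF join]
        bij_betw_inv_into[OF initial_perm_bij])
qed

end

theory Submission
  imports Defs
begin

text \<open>
  Up to the initial permutation, the right half of \<open>T\<^sub>k(L, R)\<close> is \<open>L \<oplus> f(R)\<close>, where \<open>f\<close> depends
  on the key only.  So two plaintexts that have the same \<open>R\<close> and agree in a nit of \<open>L\<close> have
  ciphertexts which agree in the corresponding nit of the right half, whatever the key is.
  In \<open>T\<^sub>k T\<^sub>k\<^sub>'\<^sup>-\<^sup>1 T\<^sub>k\<^sub>'\<^sub>'\<close> the second rounds do not cancel and \<open>L\<close> interferes; already for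
  \<open>k = k'' = 0\<^sup>2\<^sup>0\<close>, \<open>k' = 1\<^sup>2\<^sup>0\<close> two plaintexts differing in a single nit violate this.
\<close>

text \<open>The cipher conjugated by the initial permutation, with both rounds and the final swap
  multiplied out. No inverse remains, so concrete values can be evaluated.\<close>

definition edes_core :: "nat list \<Rightarrow> nat list \<Rightarrow> nat list" where
  "edes_core k s =
     (let L = take 9 s; R = drop 9 s; B = nit_add L (round_fun (subkey1 k) R)
      in nit_add R (round_fun (subkey2 k) B) @ B)"

lemma subkeys_closed:
  assumes "k \<in> edes_keys"
  shows "subkey1 k \<in> nit_strings 15" "subkey2 k \<in> nit_strings 15"
  using assms unfolding subkey1_def subkey2_def edes_keys_def
  by (auto intro!: apply_positions_closed)

lemma edes_core_closed:
  assumes k: "k \<in> edes_keys" and s: "s \<in> edes_messages"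
  shows "edes_core k s \<in> edes_messages"
proof -
  have L: "take 9 s \<in> nit_strings 9" and R: "drop 9 s \<in> nit_strings 9"
    using s by (auto simp: edes_messages_def nit_strings_iff)
  define B where "B = nit_add (take 9 s) (round_fun (subkey1 k) (drop 9 s))"
  have B: "B \<in> nit_strings 9"
    unfolding B_def by (intro nit_add_closed L R round_fun_closed subkeys_closed k)
  have "nit_add (drop 9 s) (round_fun (subkey2 k) B) \<in> nit_strings 9"
    by (intro nit_add_closed B R round_fun_closed subkeys_closed k)
  with B have "nit_add (drop 9 s) (round_fun (subkey2 k) B) @ B \<in> nit_strings 18"
    by (auto simp: nit_strings_def)
  then show ?thesis
    by (simp add: edes_core_def edes_messages_def B_def Let_def)
qed

lemma initial_perm_closed: "x \<in> edes_messages \<Longrightarrow> initial_perm x \<in> edes_messages"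
  using initial_perm_bij bij_betwE by blast

lemma initial_perm_edes:
  assumes k: "k \<in> edes_keys" and x: "x \<in> edes_messages"
  shows "initial_perm (edes k x) = edes_core k (initial_perm x)"
proof -
  have "edes k x = inv_into edes_messages initial_perm (edes_core k (initial_perm x))"
    by (simp add: edes_def edes_core_def split_halves_def feistel_step_def swap_halves_def
        join_halves_def Let_def)
  moreover have "edes_core k (initial_perm x) \<in> initial_perm ` edes_messages"
    using edes_core_closed[OF k initial_perm_closed[OF x]] bij_betw_imp_surj_on[OF initial_perm_bij]
    by simp
  ultimately show ?thesis by (simp add: f_inv_into_f)
qed

text \<open>Injectivity of \<open>initial_perm\<close> allows ciphertexts to be compared after
  applying it, so its inverse is never computed.\<close>

lemma edes_eqI:
  assumes "k \<in> edes_keys" "x \<in> edes_messages" "y \<in> edes_messages"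
    and "edes_core k (initial_perm x) = initial_perm y"
  shows "edes k x = y"
proof -
  have "edes k x \<in> edes_messages" using edes_bij assms(1,2) bij_betwE by blast
  moreover have "initial_perm (edes k x) = initial_perm y"
    using assms by (simp add: initial_perm_edes)
  ultimately show ?thesis
    using bij_betw_imp_inj_on[OF initial_perm_bij] assms(3) by (meson inj_onD)
qed

lemma edes_right_half_nth_cong:
  assumes k: "k \<in> edes_keys" and x: "x \<in> edes_messages" and x': "x' \<in> edes_messages"
    and i: "i < 9" "initial_perm x ! i = initial_perm x' ! i"
    and R: "drop 9 (initial_perm x) = drop 9 (initial_perm x')"
  shows "initial_perm (edes k x) ! (9 + i) = initial_perm (edes k x') ! (9 + i)"
proof -
  \<comment> \<open>Index \<open>9 + i\<close> lies in the second half of the core output, which is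
    the result of the first round alone.\<close>
  have "initial_perm (edes k z) ! (9 + i)
      = (initial_perm z ! i + round_fun (subkey1 k) (drop 9 (initial_perm z)) ! i) mod 3"
    if z: "z \<in> edes_messages" for z
  proof -
    have "length (initial_perm z) = 18"
      using initial_perm_closed[OF z] by (simp add: edes_messages_def nit_strings_def)
    moreover have "length (round_fun \<kappa> r) = 9" for \<kappa> r
      by (simp add: round_fun_def Let_def sbox_output_def base3_digits_def)
    ultimately show ?thesis
      using i(1) by (simp add: initial_perm_edes[OF k z] edes_core_def Let_def nit_add_def
          nth_append)
  qed
  then show ?thesis using x x' i(2) R by simp
qed

text \<open>Since \<open>edes k'\<close> is injective, exhibiting a preimage \<open>w\<close> of
  \<open>y\<close> replaces computing \<open>inv_into\<close>; only forward evaluations of the core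
  are left.\<close>

lemma edes_quotient_eqI:
  assumes k: "k \<in> edes_keys" and k': "k' \<in> edes_keys" and k'': "k'' \<in> edes_keys"
    and x: "x \<in> edes_messages" and y: "y \<in> edes_messages"
    and w: "w \<in> edes_messages" and z: "z \<in> edes_messages"
    and core: "edes_core k'' (initial_perm x) = initial_perm y"
      "edes_core k' (initial_perm w) = initial_perm y"
      "edes_core k (initial_perm w) = initial_perm z"
  shows "(edes k \<circ> inv_into edes_messages (edes k') \<circ> edes k'') x = z"
proof -
  have "edes k'' x = y" "edes k' w = y" "edes k w = z"
    using assms by (auto intro: edes_eqI)
  moreover from this(2) have "inv_into edes_messages (edes k') y = w"
    using inv_into_f_f[OF bij_betw_imp_inj_on[OF edes_bij[OF k']] w] by simp
  ultimately show ?thesis by simp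
qed

lemma edes_messages_code:
  "s \<in> edes_messages \<longleftrightarrow> length s = 18 \<and> list_all (\<lambda>a. a = 0 \<or> a = 1 \<or> a = 2) s"
  by (auto simp: edes_messages_def nit_strings_def list_all_iff)

theorem theorem5:
  shows "\<not> pure_cryptosystem edes_keys edes_messages edes"
proof
  assume pure: "pure_cryptosystem edes_keys edes_messages edes"
  define k :: "nat list" where "k = replicate 20 0"
  define k' :: "nat list" where "k' = replicate 20 1"
  define x :: "nat list" where "x = replicate 18 0"
  \<comment> \<open>The values come from running the cipher: \<open>edes k x = y\<close>,
    \<open>edes k' w = y\<close>, \<open>edes k w = z\<close>, and likewise for the primed
    messages.\<close>
  define y :: "nat list" where "y = [0,0,0,2,2,1,0,0,0,1,0,0,1,1,0,0,2,0]"
  define w :: "nat list" where "w = [1,2,2,1,0,2,1,1,0,1,2,2,2,0,2,0,0,0]"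
  define z :: "nat list" where "z = [0,2,2,1,2,0,2,2,2,0,0,1,2,1,2,0,2,1]"
  define x' :: "nat list" where "x' = 1 # replicate 17 0"
  define y' :: "nat list" where "y' = [0,0,0,2,2,1,0,2,2,2,0,0,2,1,0,2,2,0]"
  define w' :: "nat list" where "w' = [2,0,1,1,2,0,2,0,1,1,1,0,2,2,2,2,0,0]"
  define z' :: "nat list" where "z' = [2,0,1,1,0,0,0,0,2,0,2,2,0,1,2,0,1,0]"
  note defs = k_def k'_def x_def y_def w_def z_def x'_def y'_def w'_def z'_def
  have keys: "k \<in> edes_keys" "k' \<in> edes_keys"
    by (auto simp: defs edes_keys_def nit_strings_def)
  have messages: "x \<in> edes_messages" "y \<in> edes_messages" "w \<in> edes_messages" "z \<in> edes_messages"
      "x' \<in> edes_messages" "y' \<in> edes_messages" "w' \<in> edes_messages" "z' \<in> edes_messages"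
    unfolding defs edes_messages_code by code_simp+
  let ?T = "edes k \<circ> inv_into edes_messages (edes k') \<circ> edes k"
  have T: "?T x = z" "?T x' = z'"
    \<comment> \<open>The intermediate messages do not occur in the goals; they are taken from
      \<open>messages\<close>, and evaluation checks the three core equations.\<close>
    by (rule edes_quotient_eqI; (rule keys messages)?; unfold defs; code_simp)+
  obtain k''' where k''': "k''' \<in> edes_keys" "\<forall>x\<in>edes_messages. ?T x = edes k''' x"
    using pure keys unfolding pure_cryptosystem_def by blast
  then have "edes k''' x = z" "edes k''' x' = z'"
    using T messages by metis+
  \<comment> \<open>The initial permutation sends the first nit, the only difference of
    \<open>x\<close> and \<open>x'\<close>, to index 5 of the left half. Hence the right halves and
    index 0 of the left halves agree.\<close>
  moreover have "initial_perm (edes k''' x) ! (9 + 0) = initial_perm (edes k''' x') ! (9 + 0)"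
    by (rule edes_right_half_nth_cong) (use k''' messages in \<open>simp_all add: x_def x'_def initial_perm_def apply_positions_def\<close>)
  \<comment> \<open>Index 9 after \<open>initial_perm\<close> is position 17 of the ciphertext,
    where \<open>z\<close> has 2 and \<open>z'\<close> has 1.\<close>
  ultimately show False
    by (simp add: z_def z'_def initial_perm_def apply_positions_def)
qed

end
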